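(* Let $R$ be a commutative ring with identity that contains $\mathbb{Q}$, let $N \ge 2$, and write $Q = X_1^2+\cdots+X_N^2$. Every polynomial $p\in R[X_1,\ldots,X_N]$ can be expressed uniquely (up to appending zero terms) in the form $$p = p_0 + Q\,p_1 + \cdots + Q^s p_s,$$ where $p_0,\ldots,p_s \in R[X_1,\ldots,X_N]$ are harmonic polynomials. Moreover, if $p$ is homogeneous of degree $d$, then $p_j$ is $0$ or homogeneous of degree $d-2j$ for each non-negative integer $j\le d/2$.
   Context: A polynomial $p\in R[X_1,\ldots,X_N]$ is harmonic if $\Delta_N p=0$, where $\Delta_N = \partial_1^2+\cdots+\partial_N^2$ and $\partial_j = \partial/\partial X_j$. *)

theory Defs
  imports Complex_Main "HOL-Library.Poly_Mapping" "HOL-Library.Cardinality"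
begin

text \<open>
  Polynomials over a commutative ring \<open>'a\<close> in the indeterminates \<open>X\<^sub>i\<close>, \<open>i :: 'n\<close>, as finitely
  supported maps from exponent vectors to coefficients. The ring structure is the convolution
  ring of \<^theory>\<open>HOL-Library.Poly_Mapping\<close>. The number of indeterminates is \<open>CARD('n)\<close>.
\<close>

type_synonym ('n, 'a) mpoly = "('n \<Rightarrow>\<^sub>0 nat) \<Rightarrow>\<^sub>0 'a"

definition var :: "'n \<Rightarrow> ('n, 'a::comm_ring_1) mpoly" where
  "var i = Poly_Mapping.single (Poly_Mapping.single i 1) 1"

text \<open>
  Term by term, \<open>c * X\<^sup>m\<close> is sent to \<open>m\<^sub>i * c * X\<^bsup>m - e\<^sub>i\<^esup>\<close>. Subtraction of exponents is truncated,
  but the coefficient vanishes in the case \<open>m\<^sub>i = 0\<close>, where this matters.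
\<close>

definition partial_deriv ::
  "'n \<Rightarrow> ('n, 'a::comm_ring_1) mpoly \<Rightarrow> ('n, 'a) mpoly" where
  "partial_deriv i p =
     (\<Sum>m\<in>Poly_Mapping.keys p.
        Poly_Mapping.single (m - Poly_Mapping.single i 1)
          (of_nat (Poly_Mapping.lookup m i) * Poly_Mapping.lookup p m))"

definition laplacian :: "('n::finite, 'a::comm_ring_1) mpoly \<Rightarrow> ('n, 'a) mpoly" where
  "laplacian p = (\<Sum>i\<in>UNIV. partial_deriv i (partial_deriv i p))"

definition harmonic :: "('n::finite, 'a::comm_ring_1) mpoly \<Rightarrow> bool" where
  "harmonic p \<longleftrightarrow> laplacian p = 0"

definition quad_form :: "('n::finite, 'a::comm_ring_1) mpoly" where
  "quad_form = (\<Sum>i\<in>UNIV. var i ^ 2)"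

definition monom_degree :: "('n::finite \<Rightarrow>\<^sub>0 nat) \<Rightarrow> nat" where
  "monom_degree m = (\<Sum>i\<in>UNIV. Poly_Mapping.lookup m i)"

text \<open>The zero polynomial counts as homogeneous of every degree.\<close>

definition homogeneous :: "nat \<Rightarrow> ('n::finite, 'a::comm_ring_1) mpoly \<Rightarrow> bool" where
  "homogeneous d p \<longleftrightarrow> (\<forall>m\<in>Poly_Mapping.keys p. monom_degree m = d)"

text \<open>Only the values \<open>f 0, \<dots>, f s\<close> are relevant.\<close>

definition harmonic_expansion ::
  "('n::finite, 'a::comm_ring_1) mpoly \<Rightarrow> nat \<Rightarrow> (nat \<Rightarrow> ('n, 'a) mpoly) \<Rightarrow> bool" where
  "harmonic_expansion p s f \<longleftrightarrow>
     (\<forall>j\<le>s. harmonic (f j)) \<and> p = (\<Sum>j\<le>s. quad_form ^ j * f j)"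

end

theory Submission
  imports Defs
begin

text \<open>
  Write \<open>\<Delta>\<close> for the Laplacian, \<open>Q\<close> for the quadratic form and let a function \<open>\<phi>\<close> of the degree act
  diagonally on polynomials, \<open>\<phi> X\<^sup>m = \<phi>(|m|) X\<^sup>m\<close>. Such operators commute with \<open>\<Delta>\<close> and with
  multiplication by \<open>Q\<close> up to a shift of \<open>\<phi>\<close> by 2, and Euler's identity gives
  \<open>\<Delta>(Q\<^bsup>j+1\<^esup> p) = Q\<^bsup>j+1\<^esup> \<Delta>p + Q\<^sup>j c\<^sub>j p\<close> with \<open>c\<^sub>j(d) = 2(j+1)(N+2d+2j)\<close>. Hence on harmonic \<open>h\<close>
  the operator \<open>\<Delta>\<^sup>n Q\<^sup>n\<close> is the diagonal operator \<open>c\<^sub>0 \<cdots> c\<^bsub>n-1\<^esub>\<close>, which is invertible over \<open>\<rat>\<close>,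
  and \<open>\<Delta>\<^bsup>n+1\<^esup> Q\<^sup>n h = 0\<close>. Uniqueness follows by applying \<open>\<Delta>\<^sup>s\<close> to an expansion of zero with
  \<open>s + 1\<close> terms; existence by induction on the \<open>n\<close> with \<open>\<Delta>\<^sup>n p = 0\<close>. The homogeneous components
  are diagonal operators too, so projecting an expansion of a homogeneous \<open>p\<close> gives another
  expansion of \<open>p\<close>, and uniqueness applies.
\<close>

section \<open>Degrees of monomials and coefficients of derivatives\<close>

abbreviation unit_exp :: "'n \<Rightarrow> 'n \<Rightarrow>\<^sub>0 nat" where
  "unit_exp i \<equiv> Poly_Mapping.single i 1"

lemma monom_degree_add: "monom_degree (m + k) = monom_degree m + monom_degree k"
  by (simp add: monom_degree_def lookup_add sum.distrib)

lemma monom_degree_single [simp]: "monom_degree (Poly_Mapping.single i k) = k"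
  by (simp add: monom_degree_def lookup_single when_def)

lemma lookup_partial_deriv:
  "Poly_Mapping.lookup (partial_deriv i p) m =
     of_nat (Suc (Poly_Mapping.lookup m i)) * Poly_Mapping.lookup p (m + unit_exp i)"
proof -
  have "Poly_Mapping.lookup (partial_deriv i p) m =
      (\<Sum>k\<in>Poly_Mapping.keys p.
        (of_nat (Poly_Mapping.lookup k i) * Poly_Mapping.lookup p k when k - unit_exp i = m))"
    by (simp add: partial_deriv_def lookup_sum lookup_single)
  also have "\<dots> = (\<Sum>k\<in>Poly_Mapping.keys p.
        (of_nat (Poly_Mapping.lookup k i) * Poly_Mapping.lookup p k when k = m + unit_exp i))"
  proof (rule sum.cong[OF refl])
    fix k
    show "(of_nat (Poly_Mapping.lookup k i) * Poly_Mapping.lookup p k when k - unit_exp i = m) =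
      (of_nat (Poly_Mapping.lookup k i) * Poly_Mapping.lookup p k when k = m + unit_exp i)"
    \<comment> \<open>If X_i is absent from \<open>k\<close>, truncation can make
      \<open>k - unit_exp i = m\<close> hold spuriously, but then the coefficient is zero.\<close>
    proof (cases "Poly_Mapping.lookup k i = 0")
      case False
      then have "k - unit_exp i = m \<longleftrightarrow> k = m + unit_exp i"
        by (auto intro!: poly_mapping_eqI simp: lookup_add lookup_minus lookup_single when_def)
      then show ?thesis
        by (simp only:)
    qed simp
  qed
  also have "\<dots> = of_nat (Suc (Poly_Mapping.lookup m i)) * Poly_Mapping.lookup p (m + unit_exp i)"
    by (auto simp: when_def lookup_add in_keys_iff)
  finally show ?thesis .
qed

lemma partial_deriv_add: "partial_deriv i (p + q) = partial_deriv i p + partial_deriv i q"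
  by (rule poly_mapping_eqI) (simp add: lookup_partial_deriv lookup_add distrib_left)

lemma additive_partial_deriv: "additive (partial_deriv i)"
  by (simp add: additive_def partial_deriv_add)

lemma laplacian_add: "laplacian (p + q) = laplacian p + laplacian q"
  by (simp add: laplacian_def partial_deriv_add sum.distrib)

lemma additive_laplacian: "additive laplacian"
  by (simp add: additive_def laplacian_add)

lemmas laplacian_zero_diff [simp] =
  additive.zero[OF additive_laplacian] additive.diff[OF additive_laplacian]

lemma additive_laplacian_funpow: "additive (laplacian ^^ n)"
  by (induction n) (simp_all add: additive_def laplacian_add)

section \<open>Diagonal operators\<close>

text \<open>One notion covers scalars (constant \<phi>), the Euler operator (\<open>of_nat\<close>)
  and the projections to homogeneous components (indicators).\<close>

definition degree_scale :: "(nat \<Rightarrow> 'a) \<Rightarrow> ('n::finite, 'a::comm_ring_1) mpoly \<Rightarrow> ('n, 'a) mpoly" where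
  "degree_scale \<phi> p = Poly_Mapping.mapp (\<lambda>m c. \<phi> (monom_degree m) * c) p"

lemma lookup_degree_scale:
  "Poly_Mapping.lookup (degree_scale \<phi> p) m = \<phi> (monom_degree m) * Poly_Mapping.lookup p m"
  by (simp add: degree_scale_def lookup_mapp when_def in_keys_iff)

lemma degree_scale_add: "degree_scale \<phi> (p + q) = degree_scale \<phi> p + degree_scale \<phi> q"
  by (rule poly_mapping_eqI) (simp add: lookup_degree_scale lookup_add distrib_left)

lemma additive_degree_scale: "additive (degree_scale \<phi>)"
  by (simp add: additive_def degree_scale_add)

lemma degree_scale_plus:
  "degree_scale (\<lambda>d. \<phi> d + \<psi> d) p = degree_scale \<phi> p + degree_scale \<psi> p"
  by (rule poly_mapping_eqI) (simp add: lookup_degree_scale lookup_add distrib_right)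

lemma degree_scale_degree_scale:
  "degree_scale \<phi> (degree_scale \<psi> p) = degree_scale (\<lambda>d. \<phi> d * \<psi> d) p"
  by (rule poly_mapping_eqI) (simp add: lookup_degree_scale mult.assoc)

lemma degree_scale_one [simp]: "degree_scale (\<lambda>d. 1) p = p"
  by (rule poly_mapping_eqI) (simp add: lookup_degree_scale)

lemma degree_scale_of_nat: "degree_scale (\<lambda>d. of_nat n) p = of_nat n * p"
  by (induction n) (simp_all add: degree_scale_plus distrib_right,
      rule poly_mapping_eqI, simp add: lookup_degree_scale)

lemma partial_deriv_degree_scale:
  "partial_deriv i (degree_scale \<phi> p) = degree_scale (\<lambda>d. \<phi> (Suc d)) (partial_deriv i p)"
  by (rule poly_mapping_eqI)
    (simp add: lookup_partial_deriv lookup_degree_scale monom_degree_add mult.left_commute)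

lemma laplacian_degree_scale:
  "laplacian (degree_scale \<phi> p) = degree_scale (\<lambda>d. \<phi> (d + 2)) (laplacian p)"
  by (simp add: laplacian_def partial_deriv_degree_scale additive.sum[OF additive_degree_scale])

text \<open>The Laplacian only shifts \<phi> by 2, so its kernel is preserved. Dividing by
  coefficients or projecting thus never leaves the harmonic polynomials.\<close>

lemma harmonic_degree_scale: "harmonic p \<Longrightarrow> harmonic (degree_scale \<phi> p)"
  by (simp add: harmonic_def laplacian_degree_scale additive.zero[OF additive_degree_scale])

section \<open>Product rule and Euler's identity\<close>

lemma mpoly_induct [case_names monom add]:
  fixes P :: "('n, 'a::comm_ring_1) mpoly \<Rightarrow> bool"
  assumes "\<And>m c. P (Poly_Mapping.single m c)"
    and "\<And>p q. P p \<Longrightarrow> P q \<Longrightarrow> P (p + q)"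
  shows "P p"
proof (induction p rule: Poly_Mapping.update_induct)
  case const
  show ?case
    using assms(1)[of 0 0] by simp
next
  case (update p m c)
  have "Poly_Mapping.update m c p = Poly_Mapping.single m c + p"
    using update(1)
    by (auto intro!: poly_mapping_eqI simp: lookup_update lookup_add lookup_single when_def in_keys_iff)
  with assms update show ?case
    by simp
qed

lemma partial_deriv_single:
  "partial_deriv i (Poly_Mapping.single m c) =
     Poly_Mapping.single (m - unit_exp i) (of_nat (Poly_Mapping.lookup m i) * c)"
  by (simp add: partial_deriv_def)

lemma var_mult_single: "var i * Poly_Mapping.single m c = Poly_Mapping.single (unit_exp i + m) c"
  by (simp add: var_def mult_single)

lemma degree_scale_single:
  "degree_scale \<phi> (Poly_Mapping.single m c) = Poly_Mapping.single m (\<phi> (monom_degree m) * c)"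
  by (rule poly_mapping_eqI) (simp add: lookup_degree_scale lookup_single when_def)

lemma unit_exp_add_diff:
  "Poly_Mapping.lookup m i \<noteq> 0 \<Longrightarrow> unit_exp i + (m - unit_exp i) = m"
  by (rule poly_mapping_eqI) (auto simp: lookup_add lookup_minus lookup_single when_def)

lemma partial_deriv_var_mult:
  "partial_deriv i (var j * p) = (if i = j then p else 0) + var j * partial_deriv i p"
proof (induction p rule: mpoly_induct)
  case (monom m c)
  \<comment> \<open>Adding \<open>unit_exp j\<close> does not change the exponent of X_i, the only
    one where the subtraction acts, so truncation does no harm.\<close>
  have "unit_exp j + m - unit_exp i = unit_exp j + (m - unit_exp i)" if "i \<noteq> j"
    using that by (intro poly_mapping_eqI) (auto simp: lookup_add lookup_minus lookup_single when_def)
  moreover have "unit_exp i + (m - unit_exp i) = m" if "Poly_Mapping.lookup m i \<noteq> 0"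
    using that by (rule unit_exp_add_diff)
  ultimately show ?case
    by (cases "Poly_Mapping.lookup m i = 0")
      (auto simp: var_mult_single partial_deriv_single lookup_add lookup_single
        distrib_right single_add simp del: One_nat_def)
next
  case (add p q)
  then show ?case
    by (simp add: partial_deriv_add algebra_simps)
qed

text \<open>\<open>var i * partial_deriv i p\<close> scales each monomial by its i-th exponent, and
  the exponents add up to the degree.\<close>

lemma euler_identity:
  "(\<Sum>i\<in>UNIV. var i * partial_deriv i p) = degree_scale of_nat p"
proof (induction p rule: mpoly_induct)
  case (monom m c)
  have "var i * partial_deriv i (Poly_Mapping.single m c) =
      Poly_Mapping.single m (of_nat (Poly_Mapping.lookup m i) * c)" for i
    by (cases "Poly_Mapping.lookup m i = 0")
      (simp_all add: partial_deriv_single var_mult_single unit_exp_add_diff del: One_nat_def)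
  then show ?case
    by (intro poly_mapping_eqI)
      (simp add: degree_scale_single monom_degree_def lookup_sum lookup_single when_def sum_distrib_right)
next
  case (add p q)
  then show ?case
    by (simp add: partial_deriv_add degree_scale_add distrib_left sum.distrib)
qed

lemma degree_scale_var_mult:
  "degree_scale \<phi> (var i * p) = var i * degree_scale (\<lambda>d. \<phi> (Suc d)) p"
  by (induction p rule: mpoly_induct)
    (simp_all add: degree_scale_single var_mult_single monom_degree_add degree_scale_add distrib_left)

lemma degree_scale_quad_form_power_mult:
  fixes p :: "('n::finite, 'a::comm_ring_1) mpoly"
  shows "degree_scale \<phi> (quad_form ^ j * p) = quad_form ^ j * degree_scale (\<lambda>d. \<phi> (d + 2 * j)) p"
proof (induction j arbitrary: \<phi>)
  case 0
  show ?case
    by simp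
next
  case (Suc j)
  have "degree_scale \<phi> (quad_form * q) = quad_form * degree_scale (\<lambda>d. \<phi> (d + 2)) q"
    for \<phi> and q :: "('n, 'a) mpoly"
    by (simp add: quad_form_def sum_distrib_right additive.sum[OF additive_degree_scale]
        power2_eq_square mult.assoc degree_scale_var_mult)
  with Suc show ?case
    by (simp add: mult.assoc)
qed

section \<open>Commuting the Laplacian past powers of Q\<close>

lemma partial_deriv_twice_var_sq_mult:
  "partial_deriv i (partial_deriv i (var j ^ 2 * p)) =
     (if i = j then 2 * p + 4 * (var j * partial_deriv j p) else 0)
       + var j ^ 2 * partial_deriv i (partial_deriv i p)"
  by (auto simp: power2_eq_square mult.assoc partial_deriv_var_mult partial_deriv_add
      additive.zero[OF additive_partial_deriv] distrib_left mult.left_commute[of 4])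

text \<open>Summed over the N variables, the terms \<open>2 * p\<close> give 2N and, by Euler's
  identity, the first-order terms give 4d; so the commutator is diagonal.\<close>

lemma laplacian_quad_form_mult:
  fixes p :: "('n::finite, 'a::comm_ring_1) mpoly"
  shows "laplacian (quad_form * p) =
    quad_form * laplacian p + degree_scale (\<lambda>d. of_nat (2 * CARD('n) + 4 * d)) p"
proof -
  have "laplacian (var j ^ 2 * p) = 2 * p + 4 * (var j * partial_deriv j p) + var j ^ 2 * laplacian p" for j
    by (simp add: laplacian_def partial_deriv_twice_var_sq_mult sum.distrib sum_distrib_left)
  then have "laplacian (quad_form * p) =
      (\<Sum>j\<in>UNIV. 2 * p + 4 * (var j * partial_deriv j p) + var j ^ 2 * laplacian p)"
    by (simp only: quad_form_def sum_distrib_right additive.sum[OF additive_laplacian])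
  also have "\<dots> = of_nat (2 * CARD('n)) * p + 4 * degree_scale of_nat p + quad_form * laplacian p"
    by (simp add: quad_form_def sum.distrib flip: sum_distrib_left sum_distrib_right euler_identity)
  also have "of_nat (2 * CARD('n)) * p + 4 * degree_scale of_nat p =
      degree_scale (\<lambda>d. of_nat (2 * CARD('n))) p + degree_scale (\<lambda>d. of_nat 4) (degree_scale of_nat p)"
    by (simp only: degree_scale_of_nat) simp
  finally show ?thesis
    by (simp add: degree_scale_degree_scale degree_scale_plus)
qed

text \<open>Closed form of the sum of 2N + 4(d + 2i) over i \<le> j, collected while the Laplacian
  passes j + 1 factors Q.\<close>

definition laplacian_coeff :: "nat \<Rightarrow> nat \<Rightarrow> nat \<Rightarrow> nat" where
  "laplacian_coeff N j d = 2 * Suc j * (N + 2 * d + 2 * j)"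

lemma laplacian_quad_form_power_mult:
  fixes p :: "('n::finite, 'a::comm_ring_1) mpoly"
  shows "laplacian (quad_form ^ Suc j * p) = quad_form ^ Suc j * laplacian p +
    quad_form ^ j * degree_scale (\<lambda>d. of_nat (laplacian_coeff (CARD('n)) j d)) p"
proof (induction j)
  case 0
  show ?case
    by (simp add: laplacian_quad_form_mult laplacian_coeff_def algebra_simps)
next
  case (Suc j)
  let ?c = "\<lambda>j d. of_nat (laplacian_coeff (CARD('n)) j d) :: 'a"
  let ?e = "\<lambda>d. of_nat (2 * CARD('n) + 4 * d) :: 'a"
  \<comment> \<open>The factor Q pulled out multiplies a product whose degree is already raised by
    \<open>2 * Suc j\<close>, hence the shifted argument of \<open>?e\<close>.\<close>
  have coeff: "?c (Suc j) = (\<lambda>d. ?c j d + ?e (d + 2 * Suc j))"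
    by (rule ext) (simp add: laplacian_coeff_def algebra_simps)
  have "laplacian (quad_form ^ Suc (Suc j) * p) = laplacian (quad_form * (quad_form ^ Suc j * p))"
    by (simp add: mult.assoc)
  also have "\<dots> = quad_form * (quad_form ^ Suc j * laplacian p + quad_form ^ j * degree_scale (?c j) p)
      + quad_form ^ Suc j * degree_scale (\<lambda>d. ?e (d + 2 * Suc j)) p"
    by (simp only: laplacian_quad_form_mult Suc degree_scale_quad_form_power_mult)
  also have "\<dots> = quad_form ^ Suc (Suc j) * laplacian p + quad_form ^ Suc j * degree_scale (?c (Suc j)) p"
    unfolding coeff degree_scale_plus by (simp only: power_Suc distrib_left mult.assoc add.assoc)
  finally show ?case .
qed

section \<open>Iterated Laplacians\<close>

text \<open>Each Laplacian strips one Q; the diagonal factor is absorbed into \<open>h\<close>,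
  which stays harmonic, so the induction varies \<open>h\<close>.\<close>

lemma laplacian_funpow_quad_form_power_harmonic:
  fixes h :: "('n::finite, 'a::comm_ring_1) mpoly"
  assumes "harmonic h"
  shows "(laplacian ^^ n) (quad_form ^ n * h) =
    degree_scale (\<lambda>d. of_nat (\<Prod>j<n. laplacian_coeff (CARD('n)) j d)) h"
  using assms
proof (induction n arbitrary: h)
  case 0
  show ?case
    by simp
next
  case (Suc n)
  then have "(laplacian ^^ Suc n) (quad_form ^ Suc n * h) =
      (laplacian ^^ n) (quad_form ^ n * degree_scale (\<lambda>d. of_nat (laplacian_coeff (CARD('n)) n d)) h)"
    by (simp only: funpow_Suc_right o_apply laplacian_quad_form_power_mult) (simp add: harmonic_def)
  also have "\<dots> = degree_scale (\<lambda>d. of_nat (\<Prod>j<Suc n. laplacian_coeff (CARD('n)) j d)) h"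
    by (simp add: Suc.IH[OF harmonic_degree_scale[OF Suc.prems]] degree_scale_degree_scale)
  finally show ?case .
qed

text \<open>After j Laplacians only a harmonic polynomial is left, and the next one kills
  it.\<close>

lemma laplacian_funpow_quad_form_power_eq_0:
  assumes "harmonic h" "j < n"
  shows "(laplacian ^^ n) (quad_form ^ j * h) = 0"
proof -
  have "(laplacian ^^ Suc j) (quad_form ^ j * h) = 0"
    using harmonic_degree_scale[OF assms(1)]
    by (simp add: laplacian_funpow_quad_form_power_harmonic[OF assms(1)] harmonic_def)
  then have "(laplacian ^^ (n - Suc j + Suc j)) (quad_form ^ j * h) = (laplacian ^^ (n - Suc j)) 0"
    by (simp only: funpow_add o_apply)
  with assms(2) show ?thesis
    by (simp add: additive.zero[OF additive_laplacian_funpow])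
qed

lemma laplacian_funpow_eq_0:
  fixes p :: "('n::finite, 'a::comm_ring_1) mpoly"
  obtains n where "(laplacian ^^ n) p = 0"
proof -
  \<comment> \<open>Degrees drop by 2 per Laplacian; a drop of 1 suffices for the induction.\<close>
  have vanish: "(laplacian ^^ n) p = 0" if "\<And>m. monom_degree m \<ge> n \<Longrightarrow> Poly_Mapping.lookup p m = 0"
    for n and p :: "('n, 'a) mpoly"
    using that
  proof (induction n arbitrary: p)
    case 0
    then show ?case
      by (auto intro: poly_mapping_eqI)
  next
    case (Suc n)
    have "Poly_Mapping.lookup (laplacian p) m = 0" if "monom_degree m \<ge> n" for m
      using that Suc.prems
      by (simp add: laplacian_def lookup_sum lookup_partial_deriv monom_degree_add del: One_nat_def)
    then show ?case
      by (simp add: Suc.IH funpow_Suc_right del: funpow.simps)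
  qed
  \<comment> \<open>A nonzero coefficient would put \<open>m\<close> into the support, so the value
    of \<open>Max\<close> at the empty set is irrelevant.\<close>
  have "Poly_Mapping.lookup p m = 0" if "monom_degree m \<ge> Suc (Max (monom_degree ` Poly_Mapping.keys p))" for m
    using that Max_ge[of "monom_degree ` Poly_Mapping.keys p" "monom_degree m"]
    by (fastforce simp: in_keys_iff)
  then show thesis
    by (rule that[OF vanish])
qed

text \<open>
  The hypothesis \<open>of_nat (Suc n) dvd 1\<close> says that the coefficient ring contains \<open>\<rat>\<close> or is zero.
\<close>

lemma degree_scale_of_nat_inverse:
  assumes "\<And>n. of_nat (Suc n) dvd (1 :: 'a::comm_ring_1)" and "\<And>d. \<phi> d > 0"
  obtains \<psi> :: "nat \<Rightarrow> 'a::comm_ring_1"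
  where "\<And>p :: ('n::finite, 'a::comm_ring_1) mpoly. degree_scale \<psi> (degree_scale (\<lambda>d. of_nat (\<phi> d)) p) = p"
    and "\<And>p :: ('n::finite, 'a::comm_ring_1) mpoly. degree_scale (\<lambda>d. of_nat (\<phi> d)) (degree_scale \<psi> p) = p"
proof -
  have "\<exists>u. of_nat (\<phi> d) * u = (1 :: 'a)" for d
    using assms(1)[of "\<phi> d - 1"] assms(2)[of d] by (metis Suc_pred' dvdE)
  then obtain \<psi> :: "nat \<Rightarrow> 'a" where \<psi>: "of_nat (\<phi> d) * \<psi> d = 1" for d
    by metis
  then have "\<psi> d * of_nat (\<phi> d) = 1" for d
    by (simp only: mult.commute)
  with \<psi> show thesis
    by (intro that[of \<psi>]) (simp_all add: degree_scale_degree_scale)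
qed

text \<open>For N > 0 the factor \<open>N + 2 * d + 2 * j\<close> is nonzero even at d = j =
  0.\<close>

lemma prod_laplacian_coeff_pos: "N > 0 \<Longrightarrow> (\<Prod>j<n. laplacian_coeff N j d) > 0"
  by (intro prod_pos) (simp add: laplacian_coeff_def)

section \<open>Uniqueness\<close>

lemma harmonic_sum_eq_0_imp:
  fixes h :: "nat \<Rightarrow> ('n::finite, 'a::comm_ring_1) mpoly"
  assumes units: "\<And>n. of_nat (Suc n) dvd (1 :: 'a)"
    and "\<And>j. j \<le> s \<Longrightarrow> harmonic (h j)" and "(\<Sum>j\<le>s. quad_form ^ j * h j) = 0" and "j \<le> s"
  shows "h j = 0"
  using assms(2-)
proof (induction s arbitrary: j)
  case 0
  then show ?case
    by simp
next
  case (Suc s)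
  let ?k = "\<lambda>d. \<Prod>j<Suc s. laplacian_coeff (CARD('n)) j d"
  let ?c = "\<lambda>d. of_nat (?k d) :: 'a"
  obtain \<psi> where \<psi>: "\<And>p :: ('n, 'a) mpoly. degree_scale \<psi> (degree_scale ?c p) = p"
    "\<And>p :: ('n, 'a) mpoly. degree_scale ?c (degree_scale \<psi> p) = p"
    by (rule degree_scale_of_nat_inverse[where \<phi> = ?k,
        OF units prod_laplacian_coeff_pos[OF zero_less_card_finite]]) (rule that)
  \<comment> \<open>This many Laplacians kill all terms but the top one, which becomes an invertible
    diagonal operator applied to \<open>h (Suc s)\<close>.\<close>
  have "0 = (laplacian ^^ Suc s) (\<Sum>j\<le>Suc s. quad_form ^ j * h j)"
    by (simp only: Suc.prems additive.zero[OF additive_laplacian_funpow])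
  also have "\<dots> = (\<Sum>j\<le>Suc s. (laplacian ^^ Suc s) (quad_form ^ j * h j))"
    by (rule additive.sum[OF additive_laplacian_funpow])
  also have "\<dots> = (\<Sum>j\<le>s. (laplacian ^^ Suc s) (quad_form ^ j * h j)) +
      (laplacian ^^ Suc s) (quad_form ^ Suc s * h (Suc s))"
    by (rule sum.atMost_Suc)
  also have "(\<Sum>j\<le>s. (laplacian ^^ Suc s) (quad_form ^ j * h j)) = 0"
    using Suc.prems(1) by (intro sum.neutral ballI laplacian_funpow_quad_form_power_eq_0) auto
  also have "0 + (laplacian ^^ Suc s) (quad_form ^ Suc s * h (Suc s)) =
degree_scale ?c (h (Suc s))"
    using Suc.prems(1) by (simp only: add_0 laplacian_funpow_quad_form_power_harmonic order_refl)
  finally have "degree_scale ?c (h (Suc s)) = 0"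
    by (rule sym)
  then have top: "h (Suc s) = 0"
    using \<psi>(1)[of "h (Suc s)"] by (simp only: additive.zero[OF additive_degree_scale])
  show ?case
  proof (cases "j = Suc s")
    case False
    have "(\<Sum>j\<le>s. quad_form ^ j * h j) = 0"
      using Suc.prems(2) by (simp only: sum.atMost_Suc top mult_zero_right add_0_right)
    moreover have "j \<le> s"
      using Suc.prems(3) False by simp
    ultimately show ?thesis
      using Suc.IH Suc.prems(1) le_SucI by blast
  qed (simp add: top)
qed

lemma harmonic_expansion_unique:
  fixes p :: "('n::finite, 'a::comm_ring_1) mpoly"
  assumes units: "\<And>n. of_nat (Suc n) dvd (1 :: 'a)"
    and f: "harmonic_expansion p s f" and g: "harmonic_expansion p t g" and "s \<le> t" "j \<le> t"
  shows "g j = (if j \<le> s then f j else 0)"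
proof -
  \<comment> \<open>Padding the shorter expansion with zeros makes the difference an expansion of
    zero.\<close>
  define h where "h j = g j - (if j \<le> s then f j else 0)" for j
  have "(\<Sum>j\<le>t. quad_form ^ j * (if j \<le> s then f j else 0)) =
      (\<Sum>j\<le>s. quad_form ^ j * f j)"
    using \<open>s \<le> t\<close> by (intro sum.mono_neutral_cong_right) auto
  then have "(\<Sum>j\<le>t. quad_form ^ j * h j) = 0"
    using f g by (simp add: h_def harmonic_expansion_def right_diff_distrib sum_subtractf)
  moreover have "harmonic (h j)" if "j \<le> t" for j
    using f g that by (simp add: h_def harmonic_expansion_def harmonic_def)
  ultimately have "h j = 0"
    using harmonic_sum_eq_0_imp[OF units] \<open>j \<le> t\<close> by blast
  then show ?thesis
    by (simp add: h_def)
qed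

section \<open>Existence\<close>

lemma harmonic_expansion_exists:
  fixes p :: "('n::finite, 'a::comm_ring_1) mpoly"
  assumes units: "\<And>n. of_nat (Suc n) dvd (1 :: 'a)"
  shows "\<exists>s f. harmonic_expansion p s f"
proof -
  have step: "\<exists>f. harmonic_expansion p n f" if "(laplacian ^^ Suc n) p = 0"
    for n and p :: "('n, 'a) mpoly"
    using that
  proof (induction n arbitrary: p)
    case 0
    then show ?case
      by (auto simp: harmonic_expansion_def harmonic_def intro!: exI[of _ "\<lambda>_. p"])
  next
    case (Suc n)
    let ?k = "\<lambda>d. \<Prod>j<Suc n. laplacian_coeff (CARD('n)) j d"
    let ?c = "\<lambda>d. of_nat (?k d) :: 'a"
    obtain \<psi> where \<psi>: "\<And>p :: ('n, 'a) mpoly. degree_scale \<psi> (degree_scale ?c p) = p"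
      "\<And>p :: ('n, 'a) mpoly. degree_scale ?c (degree_scale \<psi> p) = p"
      by (rule degree_scale_of_nat_inverse[where \<phi> = ?k,
        OF units prod_laplacian_coeff_pos[OF zero_less_card_finite]]) (rule that)
    \<comment> \<open>The top term is chosen so that \<open>quad_form ^ Suc n * h\<close> and
      \<open>p\<close> have the same image under \<open>laplacian ^^ Suc n\<close>; their difference
      falls under the induction hypothesis.\<close>
    define h where "h = degree_scale \<psi> ((laplacian ^^ Suc n) p)"
    have h: "harmonic h"
      unfolding h_def by (rule harmonic_degree_scale) (use Suc.prems in \<open>simp add: harmonic_def\<close>)
    have "(laplacian ^^ Suc n) (quad_form ^ Suc n * h) = (laplacian ^^ Suc n) p"
      unfolding laplacian_funpow_quad_form_power_harmonic[OF h] unfolding h_def by (rule \<psi>(2))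
    then have "(laplacian ^^ Suc n) (p - quad_form ^ Suc n * h) = 0"
      by (simp only: additive.diff[OF additive_laplacian_funpow] diff_self)
    then obtain f where "harmonic_expansion (p - quad_form ^ Suc n * h) n f"
      using Suc.IH by blast
    then have "harmonic_expansion p (Suc n) (f(Suc n := h))"
      using h by (auto simp: harmonic_expansion_def diff_eq_eq le_Suc_eq)
    then show ?case
      by blast
  qed
  obtain n where "(laplacian ^^ n) p = 0"
    by (rule laplacian_funpow_eq_0)
  \<comment> \<open>One extra Laplacian brings the exponent into the successor form that
    \<open>step\<close> expects, also when n = 0.\<close>
  then have "(laplacian ^^ Suc n) p = 0"
    by simp
  with step show ?thesis
    by blast
qed

section \<open>Homogeneous polynomials\<close>

lemma degree_scale_eq_self_iff_homogeneous:
  "degree_scale (\<lambda>k. of_bool (k = d)) p = p \<longleftrightarrow> homogeneous d p"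
  by (auto simp: poly_mapping_eq_iff fun_eq_iff lookup_degree_scale homogeneous_def in_keys_iff)

lemma harmonic_expansion_homogeneous:
  fixes p :: "('n::finite, 'a::comm_ring_1) mpoly"
  assumes units: "\<And>n. of_nat (Suc n) dvd (1 :: 'a)"
    and p: "homogeneous d p" and f: "harmonic_expansion p s f" and "j \<le> s" "2 * j \<le> d"
  shows "homogeneous (d - 2 * j) (f j)"
proof -
  \<comment> \<open>The component of \<open>f j\<close> in degree d - 2j. The additive form matches
    the shift caused by \<open>quad_form ^ j\<close> and gives 0 when 2j > d.\<close>
  define g where "g j = degree_scale (\<lambda>k. of_bool (k + 2 * j = d)) (f j)" for j
  have "p = degree_scale (\<lambda>k. of_bool (k = d)) (\<Sum>j\<le>s. quad_form ^ j * f j)"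
    using p f by (simp only: harmonic_expansion_def flip: degree_scale_eq_self_iff_homogeneous)
  also have "\<dots> = (\<Sum>j\<le>s. quad_form ^ j * g j)"
    by (simp add: additive.sum[OF additive_degree_scale] degree_scale_quad_form_power_mult g_def)
  finally have "harmonic_expansion p s g"
    using f by (auto simp: harmonic_expansion_def g_def harmonic_degree_scale)
  then have "f j = g j"
    using harmonic_expansion_unique[OF units _ f] \<open>j \<le> s\<close> by fastforce
  moreover have "(k + 2 * j = d) = (k = d - 2 * j)" for k
    using \<open>2 * j \<le> d\<close> by auto
  ultimately show ?thesis
    by (simp add: g_def flip: degree_scale_eq_self_iff_homogeneous)
qed

text \<open>The map \<iota> embeds the rationals as a subring. By symmetry, s \<le> t is no
  restriction when two expansions are compared.\<close>

theorem proposition2p10: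
  fixes \<iota> :: "rat \<Rightarrow> 'a::comm_ring_1"
    and p :: "('n::finite, 'a) mpoly"
  assumes "inj \<iota>"
    and "\<iota> 1 = 1"
    and "\<And>x y. \<iota> (x + y) = \<iota> x + \<iota> y"
    and "\<And>x y. \<iota> (x * y) = \<iota> x * \<iota> y"
    and "CARD('n) \<ge> 2"
  shows "(\<exists>s f. harmonic_expansion p s f) \<and>
         (\<forall>s f t g. harmonic_expansion p s f \<and> harmonic_expansion p t g \<and> s \<le> t \<longrightarrow>
            (\<forall>j\<le>s. f j = g j) \<and> (\<forall>j. s < j \<and> j \<le> t \<longrightarrow> g j = 0)) \<and>
         (\<forall>d s f. homogeneous d p \<and> harmonic_expansion p s f \<longrightarrow>
            (\<forall>j\<le>s. 2 * j \<le> d \<longrightarrow> f j = 0 \<or> homogeneous (d - 2 * j) (f j)))"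
proof -
  have "additive \<iota>"
    using assms(3) by (simp add: additive_def)
  then have of_nat: "\<iota> (of_nat n) = of_nat n" for n
    by (induction n) (simp_all add: assms(2,3) additive.zero)
  \<comment> \<open>Since \<iota> fixes natural numbers, the image of 1 / (n + 1) inverts n +
    1.\<close>
  have units: "of_nat (Suc n) dvd (1 :: 'a)" for n
  proof
    show "1 = of_nat (Suc n) * \<iota> (1 / of_nat (Suc n))"
      by (simp add: assms(2) del: of_nat_Suc flip: of_nat assms(4))
  qed
  show ?thesis
  proof (intro conjI allI impI)
    show "\<exists>s f. harmonic_expansion p s f"
      by (rule harmonic_expansion_exists[OF units])
  next
    fix s f t g j
    assume "harmonic_expansion p s f \<and> harmonic_expansion p t g \<and> s \<le> t"
    then have unique: "g j = (if j \<le> s then f j else 0)" if "j \<le> t" for j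
      using harmonic_expansion_unique[OF units] that by blast
    show "f j = g j" if "j \<le> s"
      using unique[of j] that \<open>harmonic_expansion p s f \<and> harmonic_expansion p t g \<and> s \<le> t\<close> by simp
    show "g j = 0" if "s < j \<and> j \<le> t"
      using unique[of j] that by simp
  next
    fix d s f j
    assume "homogeneous d p \<and> harmonic_expansion p s f" "j \<le> s" "2 * j \<le> d"
    then show "f j = 0 \<or> homogeneous (d - 2 * j) (f j)"
      using harmonic_expansion_homogeneous[OF units] by blast
  qed
qed

end
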